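(* Let $(G_i,\ 0\le i<\infty)$ be events on a probability space, with indicators $I_i=1_{G_i}$ and $I_{ij}=I_iI_j=1_{G_i\cap G_j}$, and let $(X_{ij},\ 0\le i<j<\infty)$ be random variables with values in $[0,\infty]$. Assume: (i) $0\le X_{ij}\le\infty$, and $X_{ij}<\infty$ on $G_i\cap G_j$. (ii) For $i<j<k$, $X_{ik}\le X_{ij}+X_{jk}$ on $G_i\cap G_j\cap G_k$. (iii) The process $(I_i,\ 0\le i<\infty)$ is independent Bernoulli($\delta$) for some fixed $0<\delta<1$. (iv) Setting $\mathbf{X}_i=(I_i,\ X_{i,i+k},\ 1\le k<\infty)$, the process $(\mathbf{X}_i,\ 0\le i<\infty)$ is stationary and ergodic. (v) $\sup_{n\ge1} n^{-2}E[X_{0n}^2 I_{0n}]<\infty$. Then there exists a constant $0\le c<\infty$ such that $$E\left[\left|\frac{X_{0n}}{n}-c\right| I_{0n}\right]\to 0\quad\text{as } n\to\infty .$$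
   Context: Products of the form (possibly infinite quantity)$\,\cdot I_{0n}$ are interpreted as $0$ off the event $G_0\cap G_n$ (i.e. $\infty\cdot 0=0$). Stationarity and ergodicity in (iv) are with respect to the shift $i\mapsto i+1$ on the sequence $(\mathbf{X}_i)_{i\ge0}$. *)

theory Defs
  imports "HOL-Probability.Probability"
begin

definition seq_shift :: "(nat \<Rightarrow> 'b) \<Rightarrow> nat \<Rightarrow> 'b" where
  "seq_shift x = (\<lambda>i. x (Suc i))"

definition process_law :: "'a measure \<Rightarrow> 'b measure \<Rightarrow> (nat \<Rightarrow> 'a \<Rightarrow> 'b) \<Rightarrow> (nat \<Rightarrow> 'b) measure" where
  "process_law M S Y = distr M (\<Pi>\<^sub>M i\<in>UNIV. S) (\<lambda>\<omega> i. Y i \<omega>)"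

definition stationary_process :: "'a measure \<Rightarrow> 'b measure \<Rightarrow> (nat \<Rightarrow> 'a \<Rightarrow> 'b) \<Rightarrow> bool" where
  "stationary_process M S Y \<longleftrightarrow>
     (\<forall>i. Y i \<in> measurable M S) \<and>
     distr (process_law M S Y) (\<Pi>\<^sub>M i\<in>UNIV. S) seq_shift = process_law M S Y"

text \<open>Ergodicity: the law of the process is trivial on the shift-invariant measurable
  sets of sequences.\<close>

definition ergodic_process :: "'a measure \<Rightarrow> 'b measure \<Rightarrow> (nat \<Rightarrow> 'a \<Rightarrow> 'b) \<Rightarrow> bool" where
  "ergodic_process M S Y \<longleftrightarrow>
     (\<forall>A \<in> sets (\<Pi>\<^sub>M i\<in>UNIV. S).
        seq_shift -` A \<inter> space (\<Pi>\<^sub>M i\<in>UNIV. S) = A \<longrightarrow>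
        measure (process_law M S Y) A = 0 \<or> measure (process_law M S Y) A = 1)"

text \<open>The variable \<open>(I\<^sub>i, X\<^bsub>i,i+k\<^esub>, 1 \<le> k < \<infinity>)\<close> and its state space. Only the
  entries of \<open>X\<close> strictly above the diagonal are used.\<close>

definition block :: "(nat \<Rightarrow> 'a set) \<Rightarrow> (nat \<Rightarrow> nat \<Rightarrow> 'a \<Rightarrow> ennreal) \<Rightarrow>
    nat \<Rightarrow> 'a \<Rightarrow> real \<times> (nat \<Rightarrow> ennreal)" where
  "block G X i \<omega> = (indicator (G i) \<omega>, \<lambda>k\<in>{1..}. X i (i + k) \<omega>)"

definition block_space :: "(real \<times> (nat \<Rightarrow> ennreal)) measure" where
  "block_space = borel \<Otimes>\<^sub>M (\<Pi>\<^sub>M k\<in>{1..}. borel)"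

end

theory Submission
  imports Defs
begin

text \<open>
  Let \<open>hit p\<close> be the first index \<open>\<ge> p\<close> whose event occurs. The costs
  \<open>Y\<^bsub>pq\<^esub> = X\<^bsub>hit p, hit q\<^esub>\<close> (zero when \<open>hit p = hit q\<close>) are subadditive without any restriction,
  stationary and ergodic, and \<open>Y\<^bsub>0n\<^esub> = X\<^bsub>0n\<^esub>\<close> on \<open>G 0 \<inter> G n\<close>. The mean of \<open>Y\<^bsub>01\<^esub>\<close> is finite because
  the gaps between occurrences have geometric tails and the second moments of \<open>X\<^bsub>0n\<^esub>\<close> grow only
  quadratically. So it suffices to prove Kingman's theorem in \<open>L\<^sup>1\<close> for a nonnegative
  subadditive process, with limit \<open>c = inf E Y\<^bsub>0m\<^esub> / m\<close>: as \<open>E Y\<^bsub>0n\<^esub> / n \<ge> c\<close>, only the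
  positive part of \<open>Y\<^bsub>0n\<^esub> / n - c\<close> must be controlled, and it is bounded by comparing \<open>Y\<^bsub>0n\<^esub>\<close>
  with the ergodic averages of \<open>Y\<^bsub>i,i+m\<^esub> / m\<close>.
\<close>

section \<open>Ergodic theorems in mean\<close>

text \<open>Invariance is taken strictly, not modulo null sets, to match
  \<open>ergodic_process\<close>; sets to which ergodicity is applied must therefore be exactly
  invariant.\<close>

locale ergodic_transformation = prob_space M for M :: "'b measure" +
  fixes T :: "'b \<Rightarrow> 'b"
  assumes measurable_T [measurable]: "T \<in> measurable M M"
    and distr_T: "distr M M T = M"
    and ergodic: "\<And>A. A \<in> sets M \<Longrightarrow> T -` A \<inter> space M = A \<Longrightarrow> prob A = 0 \<or> prob A = 1"
begin

lemma measurable_iterate [measurable]: "(T ^^ i) \<in> measurable M M"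
  by (induction i) auto

lemma distr_iterate: "distr M M (T ^^ i) = M"
proof (induction i)
  case (Suc i)
  have "distr M M (T ^^ Suc i) = distr (distr M M (T ^^ i)) M T"
    by (subst distr_distr) auto
  then show ?case by (simp only: Suc distr_T)
qed (simp add: distr_id2)

lemma
  fixes f :: "'b \<Rightarrow> real"
  assumes [measurable]: "f \<in> borel_measurable M"
  shows integral_iterate: "(\<integral>x. f ((T ^^ i) x) \<partial>M) = (\<integral>x. f x \<partial>M)"
    and integrable_iterate_iff: "integrable M (\<lambda>x. f ((T ^^ i) x)) \<longleftrightarrow> integrable M f"
proof -
  have "(\<integral>x. f x \<partial>distr M M (T ^^ i)) = (\<integral>x. f ((T ^^ i) x) \<partial>M)"
    by (intro integral_distr) auto
  then show "(\<integral>x. f ((T ^^ i) x) \<partial>M) = (\<integral>x. f x \<partial>M)"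
    by (simp add: distr_iterate)
  have "integrable (distr M M (T ^^ i)) f \<longleftrightarrow> integrable M (\<lambda>x. f ((T ^^ i) x))"
    by (intro integrable_distr_eq) auto
  then show "integrable M (\<lambda>x. f ((T ^^ i) x)) \<longleftrightarrow> integrable M f"
    by (simp add: distr_iterate)
qed

lemma integrable_iterate:
  "integrable M f \<Longrightarrow> integrable M (\<lambda>x. f ((T ^^ i) x))" for f :: "'b \<Rightarrow> real"
  using integrable_iterate_iff[of f i] by auto

lemmas integral_T = integral_iterate[where i = 1, simplified]
  and integrable_T = integrable_iterate[where i = 1, simplified]

section \<open>Birkhoff sums, their maxima, and convergence of averages in mean\<close>

definition birkhoff_sum :: "('b \<Rightarrow> real) \<Rightarrow> nat \<Rightarrow> 'b \<Rightarrow> real" where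
  "birkhoff_sum f n x = (\<Sum>i<n. f ((T ^^ i) x))"

lemma birkhoff_sum_Suc: "birkhoff_sum f (Suc n) x = f x + birkhoff_sum f n (T x)"
  unfolding birkhoff_sum_def by (subst sum.lessThan_Suc_shift) (simp add: funpow_swap1)

lemma measurable_birkhoff_sum [measurable]:
  "f \<in> borel_measurable M \<Longrightarrow> birkhoff_sum f n \<in> borel_measurable M"
  unfolding birkhoff_sum_def[abs_def]
  by (intro borel_measurable_sum measurable_compose[OF measurable_iterate])

lemma
  assumes "integrable M f"
  shows integrable_birkhoff_sum: "integrable M (birkhoff_sum f n)"
    and integral_birkhoff_sum: "(\<integral>x. birkhoff_sum f n x \<partial>M) = n * (\<integral>x. f x \<partial>M)"
  using assms unfolding birkhoff_sum_def[abs_def]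
  by (auto simp: integrable_iterate integral_iterate Bochner_Integration.integral_sum)

text \<open>The largest of the Birkhoff sums of length \<open>1\<close> to \<open>n + 1\<close>.\<close>

primrec birkhoff_max :: "('b \<Rightarrow> real) \<Rightarrow> nat \<Rightarrow> 'b \<Rightarrow> real" where
  "birkhoff_max g 0 x = g x"
| "birkhoff_max g (Suc n) x = g x + max 0 (birkhoff_max g n (T x))"

lemma birkhoff_max_mono: "birkhoff_max g n x \<le> birkhoff_max g (Suc n) x"
  by (induction n arbitrary: x) (auto simp: max.coboundedI2 intro!: max.mono)

lemma incseq_birkhoff_max: "incseq (\<lambda>n. birkhoff_max g n x)"
  by (intro incseq_SucI birkhoff_max_mono)

lemma birkhoff_max_ge: "g x \<le> birkhoff_max g n x"
  by (cases n) auto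

lemma birkhoff_sum_le_max: "birkhoff_sum g (Suc n) x \<le> birkhoff_max g n x"
proof (induction n arbitrary: x)
  case (Suc n)
  show ?case
    using Suc[of "T x"] by (subst birkhoff_sum_Suc) simp
qed (simp add: birkhoff_sum_def)

lemma measurable_birkhoff_max [measurable]:
  assumes [measurable]: "g \<in> borel_measurable M"
  shows "birkhoff_max g n \<in> borel_measurable M"
proof (induction n)
  case (Suc n)
  note Suc [measurable]
  show ?case unfolding birkhoff_max.simps(2)[abs_def] by measurable
qed (simp add: assms)

lemma integrable_birkhoff_max:
  assumes g: "integrable M g"
  shows "integrable M (birkhoff_max g n)"
proof (induction n)
  case (Suc n)
  then show ?case
    using g integrable_T[OF Suc] unfolding birkhoff_max.simps(2)[abs_def] by auto
qed (use g in simp)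

text \<open>The increments \<open>birkhoff_max g (Suc n) - birkhoff_max g n \<circ> T\<close> have nonnegative mean, and they
  decrease to \<open>g\<close> wherever the maxima tend to infinity; by ergodicity this would happen almost
  everywhere, contradicting the negative mean of \<open>g\<close>.\<close>

lemma AE_birkhoff_sum_bounded_above:
  assumes g: "integrable M g" and neg: "(\<integral>x. g x \<partial>M) < 0"
  shows "AE x in M. \<exists>K. \<forall>n. birkhoff_sum g n x \<le> K"
proof -
  have [measurable]: "g \<in> borel_measurable M" using g by auto
  define A where "A = {x \<in> space M. \<forall>K::nat. \<exists>n. birkhoff_max g n x > K}"
  have [measurable]: "A \<in> sets M" unfolding A_def by measurable
  have unbdd: "\<exists>n. birkhoff_max g n x > r" if "x \<in> A" for x r
  proof -
    obtain K :: nat where "r \<le> K" using real_arch_simple by blast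
    moreover from that have "\<exists>n. birkhoff_max g n x > K" unfolding A_def by blast
    then obtain n where "birkhoff_max g n x > K" ..
    ultimately show ?thesis by (intro exI[of _ n]) simp
  qed
  \<comment> \<open>The recursion of \<open>birkhoff_max\<close> transfers unboundedness both ways:
    raising the threshold by \<open>\<bar>g x\<bar>\<close> absorbs the term \<open>g x\<close> and,
    in the forward direction, rules out \<open>n = 0\<close>.\<close>
  have "x \<in> A \<longleftrightarrow> T x \<in> A" if x: "x \<in> space M" for x
  proof
    assume xA: "x \<in> A"
    have "\<exists>n. birkhoff_max g n (T x) > K" for K :: nat
    proof -
      obtain n where n: "birkhoff_max g n x > \<bar>g x\<bar> + K" using unbdd[OF xA] by blast
      then show ?thesis by (cases n) (auto intro!: exI[of _ "n - 1"] simp: max_def split: if_splits)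
    qed
    then show "T x \<in> A" using measurable_space[OF measurable_T x] by (auto simp: A_def)
  next
    assume TA: "T x \<in> A"
    have "\<exists>n. birkhoff_max g n x > K" for K :: nat
    proof -
      obtain n where n: "birkhoff_max g n (T x) > \<bar>g x\<bar> + K" using unbdd[OF TA] by blast
      then show ?thesis by (intro exI[of _ "Suc n"]) auto
    qed
    then show "x \<in> A" using x by (auto simp: A_def)
  qed
  then have inv: "T -` A \<inter> space M = A" by (auto simp: A_def)
  have "prob A \<noteq> 1"
  proof
    assume "prob A = 1"
    then have AE_A: "AE x in M. x \<in> A" by (simp add: prob_eq_1)
    define d where "d n x = birkhoff_max g (Suc n) x - birkhoff_max g n (T x)" for n x
    have d_eq: "d n x = g x + max 0 (- birkhoff_max g n (T x))" for n x
      by (auto simp: d_def)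
    have "(\<lambda>n. \<integral>x. d n x \<partial>M) \<longlonglongrightarrow> (\<integral>x. g x \<partial>M)"
    proof (rule integral_dominated_convergence[where w = "\<lambda>x. \<bar>g x\<bar> + \<bar>g (T x)\<bar>"])
      show "AE x in M. (\<lambda>n. d n x) \<longlonglongrightarrow> g x"
        using AE_A
      proof eventually_elim
        case (elim x)
        then have "T x \<in> A" using inv by auto
        \<comment> \<open>From \<open>n0\<close> on the maximum along \<open>T x\<close> stays
          positive, so the correction in \<open>d_eq\<close> vanishes and the sequence is eventually
          constant.\<close>
        then obtain n0 where n0: "birkhoff_max g n0 (T x) > 0" using unbdd by blast
        have "d n x = g x" if "n \<ge> n0" for n
          using incseqD[OF incseq_birkhoff_max[of g "T x"] that] n0 by (auto simp: d_eq)
        then show ?case by (intro tendsto_eventually eventually_sequentiallyI)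
      qed
      \<comment> \<open>The maximum at \<open>T x\<close> is at least \<open>g (T x)\<close>, hence
        its negative part is at most \<open>\<bar>g (T x)\<bar>\<close>, uniformly in
        \<open>n\<close>.\<close>
      show "AE x in M. norm (d n x) \<le> \<bar>g x\<bar> + \<bar>g (T x)\<bar>" for n
        using birkhoff_max_ge[of g _ n] by (intro AE_I2) (auto simp: d_eq max_def abs_le_iff; smt)
      show "d n \<in> borel_measurable M" for n unfolding d_def[abs_def] by measurable
    qed (use g integrable_T[OF g] in auto)
    moreover have "(\<integral>x. d n x \<partial>M) \<ge> 0" for n
    proof -
      note int = integrable_birkhoff_max[OF g]
      have "(\<integral>x. d n x \<partial>M) = (\<integral>x. birkhoff_max g (Suc n) x \<partial>M) - (\<integral>x. birkhoff_max g n x \<partial>M)"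
        unfolding d_def
        by (subst Bochner_Integration.integral_diff[OF int integrable_T[OF int]])
           (simp add: integral_T)
      moreover have "(\<integral>x. birkhoff_max g n x \<partial>M) \<le> (\<integral>x. birkhoff_max g (Suc n) x \<partial>M)"
        by (intro integral_mono int birkhoff_max_mono)
      ultimately show ?thesis by simp
    qed
    ultimately have "(\<integral>x. g x \<partial>M) \<ge> 0" by (intro LIMSEQ_le_const) auto
    with neg show False by simp
  qed
  then have "prob A = 0" using ergodic[OF _ inv] by auto
  then have "AE x in M. x \<notin> A" by (simp add: prob_eq_0)
  then show ?thesis
    using AE_space
  proof eventually_elim
    case (elim x)
    then obtain K :: nat where K: "\<And>n. birkhoff_max g n x \<le> K" by (auto simp: A_def not_less)
    have "birkhoff_sum g n x \<le> K" for n
    proof (cases n)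
      case (Suc m)
      then show ?thesis using birkhoff_sum_le_max[of g m x] K[of m] by simp
    qed (simp add: birkhoff_sum_def)
    then show ?case by blast
  qed
qed

text \<open>For nonnegative \<open>f\<close> the lower bound suffices: the averages have the mean of \<open>f\<close>, so their
  expected excess over it equals their expected deficit, which is dominated by a constant.\<close>

lemma birkhoff_average_L1:
  assumes f: "integrable M f" and nn: "\<And>x. f x \<ge> 0"
  shows "(\<lambda>n. \<integral>x. \<bar>birkhoff_sum f n x / n - (\<integral>x. f x \<partial>M)\<bar> \<partial>M) \<longlonglongrightarrow> 0"
proof -
  define c where "c = (\<integral>x. f x \<partial>M)"
  have c0: "c \<ge> 0" unfolding c_def using nn by (intro integral_nonneg_AE) auto
  have [measurable]: "f \<in> borel_measurable M" using f by auto
  define a where "a n x = birkhoff_sum f n x / n" for n x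
  have a0: "a n x \<ge> 0" for n x using nn by (auto simp: a_def birkhoff_sum_def intro!: sum_nonneg divide_nonneg_nonneg)
  have int_a: "integrable M (a n)" for n
    unfolding a_def[abs_def] using integrable_birkhoff_sum[OF f] by auto
  have mean_a: "(\<integral>x. a n x \<partial>M) = c" if "n > 0" for n
    using that integral_birkhoff_sum[OF f, of n] by (simp add: a_def c_def)
  show ?thesis
    unfolding c_def[symmetric] a_def[symmetric]
  proof (rule LIMSEQ_I)
    fix r :: real assume "r > 0"
    \<comment> \<open>The final estimate is below \<open>2 * (e + e)\<close>, hence the
      quarter.\<close>
    define e where "e = r / 4"
    have e: "e > 0" using \<open>r > 0\<close> by (simp add: e_def)
    \<comment> \<open>The summand has mean \<open>- e < 0\<close>. Dividing the bound
      \<open>K\<close> by \<open>n\<close> shows that the deficit beyond \<open>e\<close> tends to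
      zero almost everywhere.\<close>
    have "AE x in M. \<exists>K. \<forall>n. birkhoff_sum (\<lambda>x. c - e - f x) n x \<le> K"
      using f e by (intro AE_birkhoff_sum_bounded_above) (auto simp: c_def[symmetric] prob_space)
    then have conv: "AE x in M. (\<lambda>n. max 0 (c - e - a n x)) \<longlonglongrightarrow> 0"
    proof eventually_elim
      case (elim x)
      then obtain K where K: "\<And>n. birkhoff_sum (\<lambda>x. c - e - f x) n x \<le> K" by blast
      have le: "c - e - a n x \<le> \<bar>K\<bar> / n" if "n > 0" for n
      proof -
        have "birkhoff_sum (\<lambda>x. c - e - f x) n x = n * (c - e - a n x)"
          using that by (simp add: birkhoff_sum_def a_def sum_subtractf right_diff_distrib)
        then show ?thesis using K[of n] that by (simp add: field_simps)
      qed
      have lim: "(\<lambda>n. \<bar>K\<bar> / real n) \<longlonglongrightarrow> 0" by (rule lim_const_over_n)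
      show ?case
        by (rule tendsto_sandwich[OF _ _ tendsto_const lim])
           (auto intro!: eventually_sequentiallyI[of 1] le)
    qed
    have "(\<lambda>n. \<integral>x. max 0 (c - e - a n x) \<partial>M) \<longlonglongrightarrow> (\<integral>x. 0 \<partial>M)"
    proof (rule integral_dominated_convergence[where w = "\<lambda>x. c"])
      show "AE x in M. norm (max 0 (c - e - a n x)) \<le> c" for n
        using a0[of n] c0 e by (intro AE_I2) (auto simp: max_def intro: order_trans[of _ 0])
      show "(\<lambda>x. max 0 (c - e - a n x)) \<in> borel_measurable M" for n
        using int_a by measurable
    qed (use conv in auto)
    then have "\<forall>\<^sub>F n in sequentially. (\<integral>x. max 0 (c - e - a n x) \<partial>M) < e"
      using e by (intro order_tendstoD(2)[where a = e]) auto
    then have "\<forall>\<^sub>F n in sequentially. (\<integral>x. \<bar>a n x - c\<bar> \<partial>M) < r"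
      using eventually_gt_at_top[of 0]
    proof eventually_elim
      case (elim n)
      \<comment> \<open>With \<open>u = c - a n x\<close>, the absolute value is twice the positive
        part of \<open>u\<close> minus \<open>u\<close>; the mean of \<open>u\<close> is
        zero.\<close>
      have "(\<integral>x. \<bar>a n x - c\<bar> \<partial>M) \<le> (\<integral>x. 2 * (e + max 0 (c - e - a n x)) - (c - a n x) \<partial>M)"
      proof (rule integral_mono)
        show "\<bar>a n x - c\<bar> \<le> 2 * (e + max 0 (c - e - a n x)) - (c - a n x)" for x
          using e by (simp add: abs_if max_def)
      qed (use int_a in auto)
      also have "\<dots> = 2 * (e + (\<integral>x. max 0 (c - e - a n x) \<partial>M)) - (c - (\<integral>x. a n x \<partial>M))"
        using int_a by (simp add: prob_space)
      also have "\<dots> < r" using elim mean_a[of n] by (simp add: e_def)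
      finally show ?case .
    qed
    then show "\<exists>no. \<forall>n\<ge>no. norm ((\<integral>x. \<bar>a n x - c\<bar> \<partial>M) - 0) < r"
      by (auto simp: eventually_sequentially)
  qed
qed


section \<open>Convergence in mean for nonnegative subadditive processes\<close>

lemma integrable_subadditive:
  fixes Y :: "nat \<Rightarrow> 'b \<Rightarrow> real"
  assumes nonneg: "\<And>n x. 0 \<le> Y n x"
    and zero: "\<And>x. Y 0 x = 0"
    and meas: "\<And>n. Y n \<in> borel_measurable M"
    and subadd: "\<And>m n x. Y (m + n) x \<le> Y m x + Y n ((T ^^ m) x)"
    and int1: "integrable M (Y 1)"
  shows "integrable M (Y n)"
proof (induction n)
  case 0
  show ?case by (simp add: zero cong: integrable_cong)
next
  case (Suc n)
  show ?case
  proof (rule Bochner_Integration.integrable_bound)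
    show "integrable M (\<lambda>x. Y n x + Y 1 ((T ^^ n) x))"
      using Suc integrable_iterate[OF int1] by auto
    show "AE x in M. norm (Y (Suc n) x) \<le> norm (Y n x + Y 1 ((T ^^ n) x))"
      using subadd[of n 1] nonneg by (intro AE_I2) auto
  qed (rule meas)
qed

text \<open>For fixed \<open>m\<close>, subadditivity bounds \<open>Y n\<close> by an ergodic
  average of \<open>Y m\<close> plus boundary terms of bounded mean. This upper bound alone controls
  the distance to \<open>c\<close> in mean, because no normalized mean lies below
  \<open>c\<close>.\<close>

lemma subadditive_L1:
  fixes Y :: "nat \<Rightarrow> 'b \<Rightarrow> real"
  assumes nonneg: "\<And>n x. 0 \<le> Y n x"
    and zero: "\<And>x. Y 0 x = 0"
    and meas: "\<And>n. Y n \<in> borel_measurable M"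
    and subadd: "\<And>m n x. Y (m + n) x \<le> Y m x + Y n ((T ^^ m) x)"
    and int1: "integrable M (Y 1)"
  shows "\<exists>c\<ge>0. (\<lambda>n. \<integral>x. \<bar>Y n x / n - c\<bar> \<partial>M) \<longlonglongrightarrow> 0"
proof -
  note int = integrable_subadditive[of Y, OF assms]
  define \<mu> where "\<mu> n = (\<integral>x. Y n x \<partial>M)" for n
  have \<mu>0: "\<mu> n \<ge> 0" for n unfolding \<mu>_def using nonneg by (intro integral_nonneg_AE) auto
  define c where "c = (INF m\<in>{1..}. \<mu> m / real m)"
  have bdd: "bdd_below ((\<lambda>m. \<mu> m / real m) ` {1..})"
    using \<mu>0 by (intro bdd_belowI2[where m = 0]) auto
  have c0: "c \<ge> 0" unfolding c_def using \<mu>0 by (intro cINF_greatest) auto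
  have c_le: "c \<le> \<mu> m / m" if "m \<ge> 1" for m
    unfolding c_def using that by (intro cINF_lower[OF bdd]) auto

  define edge where "edge m n x = (\<Sum>i<m. Y i x) + (\<Sum>i<m. Y (m - i) ((T ^^ (n + i)) x))" for m n x
  text \<open>Sum \<open>Y (i + m) \<le> Y i + Y m \<circ> T\<^sup>i\<close> over \<open>i < n\<close> and telescope, then compare \<open>Y (n + m)\<close> with each
    of the \<open>m\<close> terms that remain on the left.\<close>
  have key: "m * Y (n + m) x \<le> edge m n x + birkhoff_sum (Y m) n x" for m n x
  proof -
    have "(\<Sum>i<m. Y (n + i) x) \<le> (\<Sum>i<m. Y i x) + birkhoff_sum (Y m) n x"
    proof (induction n)
      case (Suc n)
      have "(\<Sum>i<Suc m. Y (n + i) x) = Y n x + (\<Sum>i<m. Y (Suc n + i) x)"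
        by (subst sum.lessThan_Suc_shift) simp
      moreover have "(\<Sum>i<Suc m. Y (n + i) x) = (\<Sum>i<m. Y (n + i) x) + Y (n + m) x" by simp
      moreover have "birkhoff_sum (Y m) (Suc n) x = birkhoff_sum (Y m) n x + Y m ((T ^^ n) x)"
        by (simp add: birkhoff_sum_def)
      ultimately show ?case using Suc subadd[of n m x] by linarith
    qed (simp add: birkhoff_sum_def)
    moreover have "(\<Sum>i<m. Y (n + m) x) \<le> (\<Sum>i<m. Y (n + i) x + Y (m - i) ((T ^^ (n + i)) x))"
    proof (rule sum_mono)
      fix i assume "i \<in> {..<m}"
      then show "Y (n + m) x \<le> Y (n + i) x + Y (m - i) ((T ^^ (n + i)) x)"
        using subadd[of "n + i" "m - i" x] by simp
    qed
    ultimately show ?thesis by (simp add: edge_def sum.distrib)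
  qed
  \<comment> \<open>By invariance this is the mean of \<open>edge m n\<close> for every
    \<open>n\<close>, so the boundary contribution vanishes after division by
    \<open>n\<close>.\<close>
  define \<epsilon> where "\<epsilon> m = (\<Sum>i<m. \<mu> i) + (\<Sum>i<m. \<mu> (m - i))" for m
  have int_edge: "integrable M (edge m n)" for m n
    unfolding edge_def[abs_def] by (intro Bochner_Integration.integrable_add Bochner_Integration.integrable_sum int integrable_iterate)
  have mean_edge: "(\<integral>x. edge m n x \<partial>M) = \<epsilon> m" for m n
    unfolding edge_def[abs_def] \<epsilon>_def \<mu>_def
    using int by (simp add: integrable_iterate integral_iterate meas)
  have edge0: "edge m n x \<ge> 0" for m n x
    unfolding edge_def using nonneg by (intro add_nonneg_nonneg sum_nonneg) auto

  define D where "D m n = (\<integral>x. \<bar>birkhoff_sum (Y m) n x / n - \<mu> m\<bar> \<partial>M)" for m n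
  have D: "D m \<longlonglongrightarrow> 0" for m
    unfolding D_def[abs_def] \<mu>_def using birkhoff_average_L1[OF int[of m]] nonneg by auto
  have int_D: "integrable M (\<lambda>x. \<bar>birkhoff_sum (Y m) n x / n - \<mu> m\<bar>)" for m n
    using integrable_birkhoff_sum[OF int[of m], of n] by auto

  have bound: "(\<integral>x. \<bar>Y (n + m) x / real (n + m) - c\<bar> \<partial>M)
      \<le> 2 * (\<epsilon> m / n + D m n + (\<mu> m / m - c))"
    if m: "m \<ge> 1" and n: "n \<ge> 1" for m n
  proof -
    define N where "N = n + m"
    \<comment> \<open>Three errors: boundary terms, the ergodic average of \<open>Y m\<close>, and
      the slack of \<open>m\<close> in the infimum.\<close>
    define B where "B x = edge m n x / n + \<bar>birkhoff_sum (Y m) n x / n - \<mu> m\<bar> + (\<mu> m / m - c)" for x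
    have B0: "B x \<ge> 0" for x
      unfolding B_def using edge0 c_le[OF m] by (intro add_nonneg_nonneg) auto
    have le: "Y N x / N - c \<le> B x" for x
    proof -
      define u where "u = birkhoff_sum (Y m) n x / n - \<mu> m"
      have S: "birkhoff_sum (Y m) n x = n * u + n * \<mu> m"
        using n by (simp add: u_def field_simps)
      have "real n \<le> N" "1 * real N \<le> m * real N"
        using m by (auto simp: N_def intro!: mult_right_mono)
      then have mN: "real n \<le> m * real N" "real n \<le> N" by auto
      have "Y N x / N = (m * Y N x) / (m * real N)" using m n by (simp add: N_def)
      also have "\<dots> \<le> (edge m n x + (n * u + n * \<mu> m)) / (m * real N)"
        using key[of m n x] S by (intro divide_right_mono) (auto simp: N_def)
      also have "\<dots> = edge m n x / (m * real N) + n / (m * real N) * u + (n / real N) * (\<mu> m / m)"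
        by (simp add: add_divide_distrib field_simps)
      \<comment> \<open>Each of the three terms is enlarged by raising its prefactor, using
        \<open>n \<le> N \<le> m * N\<close>; since \<open>u\<close> may be negative, it is first
        replaced by \<open>\<bar>u\<bar>\<close>.\<close>
      also have "edge m n x / (m * real N) \<le> edge m n x / n"
        using mN n edge0[of m n x] by (intro divide_left_mono) auto
      also have "n / (m * real N) * u \<le> 1 * \<bar>u\<bar>"
        using mN n by (intro order_trans[OF mult_left_mono[OF abs_ge_self] mult_right_mono]) (auto simp: divide_le_eq_1)
      also have "(n / real N) * (\<mu> m / m) \<le> 1 * (\<mu> m / m)"
        using mN n \<mu>0[of m] by (intro mult_right_mono) (auto simp: divide_le_eq_1)
      finally show ?thesis by (simp add: B_def u_def)
    qed
    have int_B: "integrable M B"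
      unfolding B_def[abs_def] using int_edge int_D by auto
    have "(\<integral>x. \<bar>Y N x / N - c\<bar> \<partial>M) \<le> (\<integral>x. 2 * B x - (Y N x / N - c) \<partial>M)"
    proof (rule integral_mono)
      show "\<bar>Y N x / N - c\<bar> \<le> 2 * B x - (Y N x / N - c)" for x
        using le[of x] B0[of x] unfolding abs_le_iff by linarith
    qed (use int[of N] int_B in auto)
    also have "\<dots> = 2 * (\<integral>x. B x \<partial>M) - (\<mu> N / N - c)"
      using int int_B by (simp add: prob_space \<mu>_def)
    also have "\<dots> \<le> 2 * (\<integral>x. B x \<partial>M)" using c_le[of N] m by (simp add: N_def)
    also have "(\<integral>x. B x \<partial>M) = \<epsilon> m / n + D m n + (\<mu> m / m - c)"
      unfolding B_def D_def using int_edge int_D by (simp add: prob_space mean_edge)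
    finally show ?thesis by (simp add: N_def)
  qed
  have "(\<lambda>n. \<integral>x. \<bar>Y n x / n - c\<bar> \<partial>M) \<longlonglongrightarrow> 0"
  proof (rule order_tendstoI)
    fix r :: real assume "r > 0"
    \<comment> \<open>\<open>m\<close> is fixed before \<open>n\<close>: a slack below
      \<open>r / 2\<close>, doubled in \<open>bound\<close>, leaves a limit below
      \<open>r\<close>.\<close>
    then have "(INF m\<in>{1..}. \<mu> m / real m) < c + r / 2" by (simp add: c_def)
    then obtain m where m: "m \<ge> 1" "\<mu> m / m < c + r / 2"
      by (subst (asm) cINF_less_iff[OF _ bdd]) auto
    have "(\<lambda>n. 2 * (\<epsilon> m / real n + D m n + (\<mu> m / m - c))) \<longlonglongrightarrow> 2 * (0 + 0 + (\<mu> m / m - c))"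
      by (intro tendsto_intros D lim_const_over_n)
    then have "\<forall>\<^sub>F n in sequentially. 2 * (\<epsilon> m / real n + D m n + (\<mu> m / m - c)) < r"
      using m by (intro order_tendstoD(2)) auto
    then have "\<forall>\<^sub>F n in sequentially. (\<integral>x. \<bar>Y (n + m) x / real (n + m) - c\<bar> \<partial>M) < r"
      using eventually_ge_at_top[of 1]
      by eventually_elim (use bound[OF m(1)] in \<open>fastforce intro: le_less_trans\<close>)
    then show "\<forall>\<^sub>F n in sequentially. (\<integral>x. \<bar>Y n x / real n - c\<bar> \<partial>M) < r"
      by (subst (asm) eventually_sequentially_seg)
  next
    fix r :: real assume "r < 0"
    then show "\<forall>\<^sub>F n in sequentially. r < (\<integral>x. \<bar>Y n x / real n - c\<bar> \<partial>M)"
      by (intro always_eventually allI less_le_trans[OF \<open>r < 0\<close>] integral_nonneg_AE) auto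
  qed
  with c0 show ?thesis by blast
qed

end

section \<open>Paths and their costs between good sites\<close>

type_synonym path = "nat \<Rightarrow> real \<times> (nat \<Rightarrow> ennreal)"

abbreviation path_space :: "path measure" where
  "path_space \<equiv> \<Pi>\<^sub>M i\<in>UNIV. block_space"

lemma measurable_path_fst [measurable]: "(\<lambda>x. fst (x i)) \<in> borel_measurable path_space"
proof -
  have "fst \<in> borel_measurable block_space" unfolding block_space_def by simp
  then show ?thesis by (rule measurable_compose[rotated]) simp
qed

lemma measurable_path_fst_eq [measurable]: "Measurable.pred path_space (\<lambda>x. fst (x i) = 1)"
  using measurable_path_fst[of i] by (rule measurable_compose) simp

lemma measurable_path_snd:
  assumes "k \<ge> 1"
  shows "(\<lambda>x. snd (x i) k) \<in> borel_measurable path_space"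
proof -
  have "(\<lambda>b. snd b k) \<in> borel_measurable block_space"
    unfolding block_space_def using assms
    by (intro measurable_compose[OF measurable_snd measurable_component_singleton]) auto
  then show ?thesis by (rule measurable_compose[rotated]) simp
qed

lemma measurable_path_snd_Suc [measurable]: "(\<lambda>x. snd (x i) (Suc k)) \<in> borel_measurable path_space"
  by (rule measurable_path_snd) simp

text \<open>The offsets \<open>Suc k\<close> and \<open>Suc l\<close> encode strict inequalities
  between sites, so only entries above the diagonal are read and measurability reduces to countable
  conjunctions.\<close>

definition good_path :: "path \<Rightarrow> bool" where
  "good_path x \<longleftrightarrow>
     (\<forall>p. \<exists>k\<ge>p. fst (x k) = 1) \<and>
     (\<forall>i k. fst (x i) = 1 \<longrightarrow> fst (x (i + Suc k)) = 1 \<longrightarrow> snd (x i) (Suc k) < \<infinity>) \<and>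
     (\<forall>i k l. fst (x i) = 1 \<longrightarrow> fst (x (i + Suc k)) = 1 \<longrightarrow> fst (x (i + Suc k + Suc l)) = 1 \<longrightarrow>
        snd (x i) (Suc (k + Suc l)) \<le> snd (x i) (Suc k) + snd (x (i + Suc k)) (Suc l))"

lemma good_pathD:
  assumes "good_path x"
  shows good_path_recurrent: "\<exists>k\<ge>p. fst (x k) = 1"
    and good_path_finite: "\<lbrakk>i < j; fst (x i) = 1; fst (x j) = 1\<rbrakk> \<Longrightarrow> snd (x i) (j - i) < \<infinity>"
    and good_path_triangle: "\<lbrakk>i < j; j < k; fst (x i) = 1; fst (x j) = 1; fst (x k) = 1\<rbrakk> \<Longrightarrow>
      snd (x i) (k - i) \<le> snd (x i) (j - i) + snd (x j) (k - j)"
proof -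
  show "\<exists>k\<ge>p. fst (x k) = 1" using assms by (simp add: good_path_def)
  show "snd (x i) (j - i) < \<infinity>" if "i < j" "fst (x i) = 1" "fst (x j) = 1"
  proof -
    obtain a where "j = i + Suc a" using less_imp_Suc_add[OF \<open>i < j\<close>] by auto
    then show ?thesis using assms that unfolding good_path_def by simp
  qed
  show "snd (x i) (k - i) \<le> snd (x i) (j - i) + snd (x j) (k - j)"
    if "i < j" "j < k" "fst (x i) = 1" "fst (x j) = 1" "fst (x k) = 1"
  proof -
    obtain a b where "j = i + Suc a" "k = i + Suc a + Suc b"
      using less_imp_Suc_add[OF \<open>i < j\<close>] less_imp_Suc_add[OF \<open>j < k\<close>] by auto
    then show ?thesis using assms that unfolding good_path_def by simp
  qed
qed

lemma measurable_good_path [measurable]: "Measurable.pred path_space good_path"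
proof -
  have fin: "Measurable.pred path_space (\<lambda>x. snd (x i) (Suc k) < \<infinity>)" for i k
    using measurable_path_snd_Suc[of i k] by simp
  have triangle: "Measurable.pred path_space (\<lambda>x. snd (x i) (Suc (k + Suc l)) \<le>
      snd (x i) (Suc k) + snd (x (i + Suc k)) (Suc l))" for i k l
    unfolding pred_def
    by (intro borel_measurable_le borel_measurable_add measurable_path_snd_Suc)
  show ?thesis
    unfolding good_path_def[abs_def]
    by (intro pred_intros_logic pred_intros_countable fin triangle measurable_path_fst_eq measurable_const) simp_all
qed

section \<open>First occurrences and the costs between them\<close>

definition hit :: "nat \<Rightarrow> path \<Rightarrow> nat" where
  "hit p x = (LEAST k. p \<le> k \<and> fst (x k) = 1)"

lemma measurable_hit [measurable]: "hit p \<in> measurable path_space (count_space UNIV)"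
  unfolding hit_def[abs_def]
  by (intro measurable_Least pred_intros_logic measurable_path_fst_eq measurable_const) simp

lemma hit:
  assumes "good_path x"
  shows hit_ge: "p \<le> hit p x" and fst_hit: "fst (x (hit p x)) = 1"
  using LeastI_ex[of "\<lambda>k. p \<le> k \<and> fst (x k) = 1"] good_path_recurrent[OF assms, of p]
  unfolding hit_def by auto

lemma hit_le: "p \<le> k \<Longrightarrow> fst (x k) = 1 \<Longrightarrow> hit p x \<le> k"
  unfolding hit_def by (rule Least_le) simp

lemma hit_eq: "fst (x p) = 1 \<Longrightarrow> hit p x = p"
  unfolding hit_def by (rule Least_equality) auto

lemma hit_mono:
  assumes "good_path x" "p \<le> q"
  shows "hit p x \<le> hit q x"
  using hit_ge[OF assms(1), of q] fst_hit[OF assms(1), of q] assms(2) by (intro hit_le) auto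

text \<open>Off good paths the cost is zero, so that subadditivity holds everywhere and not only almost
  everywhere. The second test excludes the diagonal, where the entries of \<open>x\<close> are junk.\<close>

definition path_cost :: "nat \<Rightarrow> nat \<Rightarrow> path \<Rightarrow> real" where
  "path_cost p q x =
     (if good_path x \<and> hit p x < hit q x then enn2real (snd (x (hit p x)) (hit q x - hit p x)) else 0)"

lemma path_cost_nonneg [simp]: "0 \<le> path_cost p q x"
  by (simp add: path_cost_def)

lemma path_cost_same [simp]: "path_cost p p x = 0"
  by (simp add: path_cost_def)

lemma measurable_path_cost [measurable]: "path_cost p q \<in> borel_measurable path_space"
proof -
  \<comment> \<open>Both random indices are frozen at constants, then restored one at a time, as
    each has countably many values.\<close>
  have *: "(\<lambda>x. if a < b then enn2real (snd (x a) (b - a)) else 0) \<in> borel_measurable path_space"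
    for a b :: nat
  proof (cases "a < b")
    case True
    then have [measurable]: "(\<lambda>x. snd (x a) (b - a)) \<in> borel_measurable path_space"
      by (intro measurable_path_snd) simp
    show ?thesis using True by simp
  qed simp
  have 1: "(\<lambda>x. if hit p x < b then enn2real (snd (x (hit p x)) (b - hit p x)) else 0)
      \<in> borel_measurable path_space" for b
    by (rule measurable_compose_countable[OF * measurable_hit])
  have "(\<lambda>x. if hit p x < hit q x then enn2real (snd (x (hit p x)) (hit q x - hit p x)) else 0)
      \<in> borel_measurable path_space"
    by (rule measurable_compose_countable[OF 1 measurable_hit])
  then have "(\<lambda>x. if good_path x then if hit p x < hit q x
      then enn2real (snd (x (hit p x)) (hit q x - hit p x)) else 0 else 0)
      \<in> borel_measurable path_space"
    by (rule measurable_If[OF _ measurable_const measurable_good_path[unfolded pred_def]]) simp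
  also have "(\<lambda>x. if good_path x then if hit p x < hit q x
      then enn2real (snd (x (hit p x)) (hit q x - hit p x)) else 0 else 0) = path_cost p q"
    by (auto simp: path_cost_def)
  finally show ?thesis .
qed

text \<open>Hits are monotone in the starting index. If two neighbouring hits coincide, one cost on
  the right is zero and the other equals the left side; otherwise the triangle inequality of good
  paths applies to three distinct sites.\<close>

lemma path_cost_triangle:
  assumes "p \<le> q" "q \<le> r"
  shows "path_cost p r x \<le> path_cost p q x + path_cost q r x"
proof (cases "good_path x")
  case good: True
  let ?a = "hit p x" and ?b = "hit q x" and ?c = "hit r x"
  have le: "?a \<le> ?b" "?b \<le> ?c" using assms by (auto intro: hit_mono good)
  show ?thesis
  proof (cases "?a < ?b \<and> ?b < ?c")
    case True
    then have *: "?a < ?b" "?b < ?c" by auto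
    note f = fst_hit[OF good]
    have fin: "snd (x ?a) (?b - ?a) < top" "snd (x ?b) (?c - ?b) < top"
      using good_path_finite[OF good *(1) f f] good_path_finite[OF good *(2) f f] by auto
    then have "enn2real (snd (x ?a) (?c - ?a)) \<le> enn2real (snd (x ?a) (?b - ?a) + snd (x ?b) (?c - ?b))"
      by (intro enn2real_mono good_path_triangle[OF good * f f f]) simp
    then show ?thesis using good * fin by (simp add: path_cost_def enn2real_plus)
  qed (use le good in \<open>auto simp: path_cost_def\<close>)
qed (simp add: path_cost_def)

lemma funpow_seq_shift: "(seq_shift ^^ m) x = (\<lambda>i. x (m + i))"
  by (induction m) (auto simp: seq_shift_def)

lemma good_path_shift:
  assumes "good_path x"
  shows "good_path ((seq_shift ^^ m) x)"
proof -
  have "\<exists>k\<ge>p. fst (x (m + k)) = 1" for p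
  proof -
    obtain k where "k \<ge> m + p" "fst (x k) = 1" using good_path_recurrent[OF assms] by blast
    then show ?thesis by (intro exI[of _ "k - m"]) auto
  qed
  then show ?thesis
    using assms unfolding good_path_def funpow_seq_shift by (auto simp: add.assoc)
qed

lemma hit_shift:
  assumes "good_path x"
  shows "m + hit p ((seq_shift ^^ m) x) = hit (m + p) x"
proof (rule antisym)
  note shifted = good_path_shift[OF assms, of m]
  show "hit (m + p) x \<le> m + hit p ((seq_shift ^^ m) x)"
    using hit_ge[OF shifted, of p] fst_hit[OF shifted, of p]
    by (intro hit_le) (auto simp: funpow_seq_shift)
  have "m + p \<le> hit (m + p) x" "fst (x (hit (m + p) x)) = 1"
    using hit_ge[OF assms] fst_hit[OF assms] by auto
  then have "hit p ((seq_shift ^^ m) x) \<le> hit (m + p) x - m"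
    by (intro hit_le) (auto simp: funpow_seq_shift)
  then show "m + hit p ((seq_shift ^^ m) x) \<le> hit (m + p) x"
    using \<open>m + p \<le> hit (m + p) x\<close> by linarith
qed

text \<open>Shifting moves all hits by the same amount, and blocks are indexed by displacement, so
  the same entry is read.\<close>

lemma path_cost_shift:
  assumes "good_path x"
  shows "path_cost p q ((seq_shift ^^ m) x) = path_cost (m + p) (m + q) x"
  using assms good_path_shift[OF assms, of m]
  unfolding path_cost_def hit_shift[OF assms, symmetric] by (simp add: funpow_seq_shift)

lemma path_cost_subadditive:
  "path_cost 0 (m + n) x \<le> path_cost 0 m x + path_cost 0 n ((seq_shift ^^ m) x)"
proof (cases "good_path x")
  case True
  then show ?thesis
    using path_cost_triangle[of 0 m "m + n" x] by (simp add: path_cost_shift)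
qed (simp add: path_cost_def[of 0 "m + n"])

lemma path_cost_eq:
  assumes "good_path x" "fst (x 0) = 1" "fst (x n) = 1" "n > 0"
  shows "path_cost 0 n x = enn2real (snd (x 0) n)"
  using assms by (simp add: path_cost_def hit_eq)

text \<open>A nonzero cost forces the hits from \<open>0\<close> and \<open>1\<close> to differ,
  hence an occurrence at \<open>0\<close>. The sum splits according to the next occurrence
  \<open>Suc k\<close>, making the geometric law of the gap usable.\<close>

lemma ennreal_path_cost_1_le:
  "ennreal (path_cost 0 1 x)
     \<le> (\<Sum>k. if fst (x 0) = 1 \<and> fst (x (Suc k)) = 1 \<and> (\<forall>j\<in>{1..k}. fst (x j) \<noteq> 1)
             then snd (x 0) (Suc k) else 0)" (is "_ \<le> (\<Sum>k. ?f k)")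
proof (cases "good_path x \<and> hit 0 x < hit 1 x")
  case True
  then have good: "good_path x" and lt: "hit 0 x < hit 1 x" by auto
  have h0: "hit 0 x = 0"
    using lt hit_le[of 1 "hit 0 x" x] fst_hit[OF good, of 0] by (cases "hit 0 x") auto
  obtain k where k: "hit 1 x = Suc k" using lt by (cases "hit 1 x") auto
  have "fst (x j) \<noteq> 1" if "j \<in> {1..k}" for j
    using hit_le[of 1 j x] k that by auto
  then have "?f k = snd (x 0) (Suc k)"
    using fst_hit[OF good, of 0] fst_hit[OF good, of 1] h0 k by auto
  moreover have "ennreal (path_cost 0 1 x) \<le> snd (x 0) (Suc k)"
    using True h0 k by (simp add: path_cost_def ennreal_enn2real_if)
  moreover have "?f k \<le> (\<Sum>k. ?f k)"
    using sum_le_suminf[of ?f "{k}"] by simp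
  ultimately show ?thesis by simp
qed (auto simp: path_cost_def)

section \<open>Elementary estimates for the moment bound\<close>

lemma summable_power_times_square:
  fixes t :: real
  assumes "0 < t" "t < 1"
  shows "summable (\<lambda>k. t ^ k * (C * (real (Suc k))\<^sup>2 + 1))"
proof -
  \<comment> \<open>Of the three factors \<open>u ^ k\<close> in \<open>t ^ k\<close>, two absorb
    the square and the third leaves a geometric series. The bound \<open>B\<close> is used at
    \<open>Suc k\<close>, which costs the factor \<open>1 / u\<close>.\<close>
  define u where "u = root 3 t"
  have u: "0 < u" "u < 1" "t = u ^ 3" using assms by (auto simp: u_def)
  have "(\<lambda>k. real k * u ^ k) \<longlonglongrightarrow> 0" using u by (intro powser_times_n_limit_0) auto
  then obtain B where B: "\<And>k. real k * u ^ k \<le> B"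
    by (metis Bseq_def abs_le_D1 convergentI convergent_imp_Bseq real_norm_def)
  have "summable (\<lambda>k. t ^ k * (real (Suc k))\<^sup>2)"
  proof (rule summable_comparison_test'[of "\<lambda>k. (B / u)\<^sup>2 * u ^ k" 0])
    show "summable (\<lambda>k. (B / u)\<^sup>2 * u ^ k)" using u by (intro summable_mult summable_geometric) auto
    fix k :: nat
    have "(real (Suc k) * u ^ k)\<^sup>2 \<le> (B / u)\<^sup>2"
      using B[of "Suc k"] u by (intro power_mono) (auto simp: field_simps)
    then have "(real (Suc k) * u ^ k)\<^sup>2 * u ^ k \<le> (B / u)\<^sup>2 * u ^ k"
      using u by (intro mult_right_mono) auto
    also have "(real (Suc k) * u ^ k)\<^sup>2 * u ^ k = t ^ k * (real (Suc k))\<^sup>2"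
      by (simp add: u(3) power_mult_distrib power2_eq_square power3_eq_cube)
    finally show "norm (t ^ k * (real (Suc k))\<^sup>2) \<le> (B / u)\<^sup>2 * u ^ k" using assms by simp
  qed
  from summable_add[OF summable_mult[OF this, of C] summable_geometric[of t]] show ?thesis
    using assms by (simp add: algebra_simps)
qed


text \<open>Either \<open>X\<close> is at most \<open>1 / s\<close>, or it is at most
  \<open>s * X\<^sup>2\<close>. The free weight \<open>s\<close> serves in place of the
  Cauchy-Schwarz inequality to trade second moments against the probability of a long gap.\<close>

lemma ennreal_le_square:
  fixes X :: ennreal
  assumes "0 < s"
  shows "X \<le> ennreal s * X\<^sup>2 + ennreal (1 / s)"
proof (cases X)
  case (real r)
  have "r \<le> s * r\<^sup>2 + 1 / s"
  proof (cases "s * r \<le> 1")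
    case True
    then have "r \<le> 1 / s" using assms by (simp add: field_simps)
    moreover have "s * r\<^sup>2 \<ge> 0" using assms by simp
    ultimately show ?thesis by linarith
  next
    case False
    then have *: "1 * r \<le> (s * r) * r" using real by (intro mult_right_mono) auto
    have "1 / s > 0" using assms by simp
    then have "r \<le> s * r * r + 1 / s" using * by linarith
    then show ?thesis by (simp add: power2_eq_square mult.assoc)
  qed
  then show ?thesis using real assms
    by (simp add: ennreal_power ennreal_mult[symmetric] ennreal_plus[symmetric] del: ennreal_plus)
next
  case top
  then show ?thesis using assms by (simp add: power2_eq_square ennreal_mult_top)
qed

section \<open>Geometric gaps and integrability\<close>

locale bernoulli_events = prob_space M for M :: "'a measure" +
  fixes G :: "nat \<Rightarrow> 'a set" and \<delta> :: real
  assumes G [measurable]: "\<And>i. G i \<in> sets M"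
    and \<delta>: "0 < \<delta>" "\<delta> < 1"
    and indep: "indep_vars (\<lambda>i. borel) (\<lambda>i. indicat_real (G i)) UNIV"
    and bernoulli: "\<And>i. distr M borel (indicat_real (G i)) =
           distr (measure_pmf (bernoulli_pmf \<delta>)) borel of_bool"
begin

lemma prob_avoid:
  assumes "finite J"
  shows "prob {\<omega> \<in> space M. \<forall>j\<in>J. \<omega> \<notin> G j} = (1 - \<delta>) ^ card J"
proof (cases "J = {}")
  case False
  have one: "prob (indicat_real (G j) -` {0} \<inter> space M) = 1 - \<delta>" for j
  proof -
    have "prob (indicat_real (G j) -` {0} \<inter> space M) = measure (distr M borel (indicat_real (G j))) {0}"
      by (subst measure_distr) auto
    also have "\<dots> = measure (measure_pmf (bernoulli_pmf \<delta>)) (of_bool -` {0::real})"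
      by (simp add: bernoulli measure_distr)
    also have "of_bool -` {0::real} = {False}" by auto
    finally show ?thesis using \<delta> by (simp add: measure_pmf_single)
  qed
  have "{\<omega> \<in> space M. \<forall>j\<in>J. \<omega> \<notin> G j} = (\<Inter>j\<in>J. indicat_real (G j) -` {0} \<inter> space M)"
    using False by (auto simp: indicator_def)
  also have "prob \<dots> = (\<Prod>j\<in>J. prob (indicat_real (G j) -` {0} \<inter> space M))"
    using indep assms False by (intro indep_varsD) auto
  finally show ?thesis by (simp add: one)
qed (simp add: prob_space)

text \<open>Avoiding \<open>n\<close> consecutive sites has probability
  \<open>(1 - \<delta>) ^ n\<close>, which tends to zero.\<close>

lemma AE_recurrent: "AE \<omega> in M. \<forall>p. \<exists>k\<ge>p. \<omega> \<in> G k"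
proof -
  have "AE \<omega> in M. \<exists>k\<ge>p. \<omega> \<in> G k" for p
  proof -
    define N where "N = {\<omega> \<in> space M. \<forall>k\<ge>p. \<omega> \<notin> G k}"
    have [measurable]: "N \<in> sets M" unfolding N_def by measurable
    have "prob N \<le> (1 - \<delta>) ^ n" for n
    proof -
      have "prob N \<le> prob {\<omega> \<in> space M. \<forall>j\<in>{p..<p + n}. \<omega> \<notin> G j}"
        by (intro finite_measure_mono) (auto simp: N_def)
      then show ?thesis by (simp add: prob_avoid)
    qed
    moreover have "(\<lambda>n. (1 - \<delta>) ^ n) \<longlonglongrightarrow> 0" using \<delta> by (intro LIMSEQ_realpow_zero) auto
    ultimately have "prob N \<le> 0" by (intro LIMSEQ_le_const) auto
    then have "prob N = 0" using measure_nonneg[of M N] by linarith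
    then have "AE \<omega> in M. \<omega> \<notin> N" by (simp add: prob_eq_0)
    then show ?thesis using AE_space by eventually_elim (auto simp: N_def)
  qed
  then show ?thesis by (simp add: AE_all_countable)
qed

lemma nn_integral_path_cost_1:
  fixes X :: "nat \<Rightarrow> nat \<Rightarrow> 'a \<Rightarrow> ennreal"
  assumes X: "\<And>i j. i < j \<Longrightarrow> X i j \<in> borel_measurable M"
    and "(SUP n\<in>{1::nat..}.
      (\<integral>\<^sup>+\<omega>. (X 0 n \<omega>)\<^sup>2 * indicator (G 0 \<inter> G n) \<omega> \<partial>M) / (of_nat n)\<^sup>2) < \<infinity>" (is "?S < _")
  shows "(\<integral>\<^sup>+\<omega>. ennreal (path_cost 0 1 (\<lambda>i. block G X i \<omega>)) \<partial>M) < \<infinity>"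
proof -
  obtain C where C: "C \<ge> 0" "?S = ennreal C"
    using assms(2) by (cases ?S rule: ennreal_cases) (auto simp only: infinity_ennreal_def less_irrefl)
  have second_moment: "(\<integral>\<^sup>+\<omega>. (X 0 (Suc k) \<omega>)\<^sup>2 * indicator (G 0 \<inter> G (Suc k)) \<omega> \<partial>M)
      \<le> ennreal (C * (real (Suc k))\<^sup>2)" (is "?I \<le> _") for k
  proof -
    have "?I / (of_nat (Suc k))\<^sup>2 \<le> ennreal C" unfolding C(2)[symmetric] by (rule SUP_upper) simp
    then have "?I / ennreal ((real (Suc k))\<^sup>2) * ennreal ((real (Suc k))\<^sup>2)
        \<le> ennreal C * ennreal ((real (Suc k))\<^sup>2)"
      by (intro mult_right_mono) (auto simp: ennreal_of_nat_eq_real_of_nat ennreal_power simp del: of_nat_Suc)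
    also have "?I / ennreal ((real (Suc k))\<^sup>2) * ennreal ((real (Suc k))\<^sup>2) = ?I"
      by (subst ennreal_divide_times) (simp add: ennreal_mult_divide_eq mult.commute)
    finally show ?thesis using C(1) by (simp add: ennreal_mult)
  qed
  define gap where "gap k = {\<omega> \<in> space M. \<forall>j\<in>{1..k}. \<omega> \<notin> G j}" for k
  have gap [measurable]: "gap k \<in> sets M" for k unfolding gap_def by measurable
  note [measurable] = X[of 0 "Suc _", simplified]
  \<comment> \<open>A gap through \<open>k\<close> sites has probability \<open>t ^ (2 * k)\<close>.
    Weighting the square by \<open>t ^ k\<close> therefore leaves decay of order
    \<open>t ^ k\<close> in both terms, against quadratic growth of the second moment.\<close>
  define t where "t = sqrt (1 - \<delta>)"
  have t: "0 < t" "t < 1" "t\<^sup>2 = 1 - \<delta>" using \<delta> by (auto simp: t_def)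
  define f where "f k \<omega> = X 0 (Suc k) \<omega> * indicator (G 0 \<inter> G (Suc k)) \<omega> * indicator (gap k) \<omega>" for k \<omega>
  have [measurable]: "f k \<in> borel_measurable M" for k unfolding f_def[abs_def] by measurable
  have f_le: "(\<integral>\<^sup>+\<omega>. f k \<omega> \<partial>M) \<le> ennreal (t ^ k * (C * (real (Suc k))\<^sup>2 + 1))" for k
  proof -
    have tk: "t ^ k > 0" using t by simp
    have "(\<integral>\<^sup>+\<omega>. f k \<omega> \<partial>M) \<le> (\<integral>\<^sup>+\<omega>. ennreal (t ^ k) * ((X 0 (Suc k) \<omega>)\<^sup>2 * indicator (G 0 \<inter> G (Suc k)) \<omega>)
        + ennreal (1 / t ^ k) * indicator (gap k) \<omega> \<partial>M)"
      using ennreal_le_square[OF tk]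
      by (intro nn_integral_mono) (auto simp: f_def split: split_indicator)
    also have "\<dots> = ennreal (t ^ k) * (\<integral>\<^sup>+\<omega>. (X 0 (Suc k) \<omega>)\<^sup>2 * indicator (G 0 \<inter> G (Suc k)) \<omega> \<partial>M)
        + ennreal (1 / t ^ k) * emeasure M (gap k)"
      by (subst nn_integral_add) (auto simp: nn_integral_cmult)
    also have "\<dots> \<le> ennreal (t ^ k) * ennreal (C * (real (Suc k))\<^sup>2)
        + ennreal (1 / t ^ k) * emeasure M (gap k)"
      by (intro add_right_mono mult_left_mono second_moment) simp
    also have "emeasure M (gap k) = ennreal ((t\<^sup>2) ^ k)"
      using prob_avoid[of "{1..k}"] by (simp add: emeasure_eq_measure gap_def t)
    also have "ennreal (1 / t ^ k) * ennreal ((t\<^sup>2) ^ k) = ennreal (t ^ k)"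
      using t(1) by (simp add: ennreal_mult[symmetric] power2_eq_square power_mult_distrib)
    also have "ennreal (t ^ k) * ennreal (C * (real (Suc k))\<^sup>2) + ennreal (t ^ k)
        = ennreal (t ^ k * (C * (real (Suc k))\<^sup>2 + 1))"
      using tk C(1)
      by (simp add: ennreal_mult[symmetric] ennreal_plus[symmetric] distrib_left del: ennreal_plus of_nat_Suc)
    finally show ?thesis .
  qed
  have "(\<integral>\<^sup>+\<omega>. ennreal (path_cost 0 1 (\<lambda>i. block G X i \<omega>)) \<partial>M) \<le> (\<integral>\<^sup>+\<omega>. (\<Sum>k. f k \<omega>) \<partial>M)"
  proof (intro nn_integral_mono)
    fix \<omega> assume "\<omega> \<in> space M"
    then show "ennreal (path_cost 0 1 (\<lambda>i. block G X i \<omega>)) \<le> (\<Sum>k. f k \<omega>)"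
      by (intro order_trans[OF ennreal_path_cost_1_le] suminf_le)
         (auto simp: f_def block_def gap_def split: split_indicator)
  qed
  also have "\<dots> = (\<Sum>k. \<integral>\<^sup>+\<omega>. f k \<omega> \<partial>M)" by (intro nn_integral_suminf) simp
  also have "\<dots> \<le> (\<Sum>k. ennreal (t ^ k * (C * (real (Suc k))\<^sup>2 + 1)))"
    by (intro suminf_le f_le) auto
  also have "\<dots> < \<infinity>"
  proof -
    have "summable (\<lambda>k. t ^ k * (C * (real (Suc k))\<^sup>2 + 1))" using t by (intro summable_power_times_square)
    then have "(\<Sum>k. ennreal (t ^ k * (C * (real (Suc k))\<^sup>2 + 1))) \<noteq> top"
      using t C(1) by (intro ennreal_suminf_neq_top) auto
    then show ?thesis by (simp add: top.not_eq_extremum)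
  qed
  finally show ?thesis .
qed

end

section \<open>Transfer from the law of the blocks on path space to the original variables\<close>

theorem proposition4:
  fixes M :: "'a measure"
    and G :: "nat \<Rightarrow> 'a set"
    and X :: "nat \<Rightarrow> nat \<Rightarrow> 'a \<Rightarrow> ennreal"
    and \<delta> :: real
  assumes "prob_space M"
    and "\<And>i. G i \<in> sets M"
    and "\<And>i j. i < j \<Longrightarrow> X i j \<in> borel_measurable M"
    and "\<And>i j \<omega>. i < j \<Longrightarrow> \<omega> \<in> G i \<inter> G j \<Longrightarrow> X i j \<omega> < \<infinity>"
    and "\<And>i j k \<omega>. i < j \<Longrightarrow> j < k \<Longrightarrow> \<omega> \<in> G i \<inter> G j \<inter> G k \<Longrightarrow>
           X i k \<omega> \<le> X i j \<omega> + X j k \<omega>"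
    and "0 < \<delta>" and "\<delta> < 1"
    and "prob_space.indep_vars M (\<lambda>i. borel) (\<lambda>i. indicat_real (G i)) UNIV"
    and "\<And>i. distr M borel (indicat_real (G i)) =
           distr (measure_pmf (bernoulli_pmf \<delta>)) borel of_bool"
    and "stationary_process M block_space (block G X)"
    and "ergodic_process M block_space (block G X)"
    and "(SUP n\<in>{1::nat..}.
            (\<integral>\<^sup>+\<omega>. (X 0 n \<omega>)\<^sup>2 * indicator (G 0 \<inter> G n) \<omega> \<partial>M) / (of_nat n)\<^sup>2) < \<infinity>"
  \<comment> \<open>\<open>X 0 n\<close> is finite on \<open>G 0 \<inter> G n\<close>, and elsewhere the indicator makes the integrand zero,
    so the value \<open>enn2real \<infinity> = 0\<close> plays no role\<close>
  shows "\<exists>c::real. 0 \<le> c \<and>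
           (\<lambda>n. \<integral>\<^sup>+\<omega>. ennreal \<bar>enn2real (X 0 n \<omega>) / real n - c\<bar>
                  * indicator (G 0 \<inter> G n) \<omega> \<partial>M) \<longlonglongrightarrow> 0"
proof -
  interpret prob_space M by (rule assms(1))
  interpret bernoulli_events M G \<delta> by unfold_locales (fact assms)+
  let ?\<pi> = "\<lambda>\<omega> i. block G X i \<omega>"
  have [measurable]: "?\<pi> \<in> measurable M path_space"
    using assms(10) unfolding stationary_process_def by (intro measurable_abs_UNIV) auto
  have shift [measurable]: "seq_shift \<in> measurable path_space path_space"
    unfolding seq_shift_def[abs_def] by (intro measurable_abs_UNIV measurable_component_singleton) simp
  define Q where "Q = process_law M block_space (block G X)"
  have Q: "Q = distr M path_space ?\<pi>" by (simp add: Q_def process_law_def)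
  have sets_Q [measurable_cong]: "sets Q = sets path_space" and space_Q: "space Q = space path_space"
    by (simp_all add: Q)
  interpret Q: prob_space Q unfolding Q by (intro prob_space_distr) simp
  interpret Q: ergodic_transformation Q seq_shift
  proof
    show "seq_shift \<in> measurable Q Q" by measurable
    have "distr Q Q seq_shift = distr Q path_space seq_shift" by (rule distr_cong) (auto simp: sets_Q)
    then show "distr Q Q seq_shift = Q"
      using assms(10) by (simp add: stationary_process_def Q_def)
    fix A assume "A \<in> sets Q" "seq_shift -` A \<inter> space Q = A"
    then show "Q.prob A = 0 \<or> Q.prob A = 1"
      using assms(11) unfolding ergodic_process_def Q_def[symmetric] sets_Q space_Q by blast
  qed
  have meas_Q [measurable]: "path_cost p q \<in> borel_measurable Q" for p q by measurable
  have "integrable Q (path_cost 0 1)"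
  proof (rule integrableI_nonneg)
    have "(\<integral>\<^sup>+x. ennreal (path_cost 0 1 x) \<partial>Q) = (\<integral>\<^sup>+\<omega>. ennreal (path_cost 0 1 (?\<pi> \<omega>)) \<partial>M)"
      unfolding Q by (intro nn_integral_distr) auto
    also have "\<dots> < \<infinity>" by (intro nn_integral_path_cost_1 assms)
    finally show "(\<integral>\<^sup>+x. ennreal (path_cost 0 1 x) \<partial>Q) < \<infinity>" .
  qed auto
  note Y = path_cost_nonneg path_cost_same meas_Q path_cost_subadditive this
  obtain c where c: "c \<ge> 0" "(\<lambda>n. \<integral>x. \<bar>path_cost 0 n x / n - c\<bar> \<partial>Q) \<longlonglongrightarrow> 0"
    using Q.subadditive_L1[of "path_cost 0", OF Y] by auto
  note int = Q.integrable_subadditive[of "path_cost 0", OF Y]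
  \<comment> \<open>Finiteness and the triangle inequality hold at every point by hypothesis; only
    recurrence needs an exceptional null set.\<close>
  have AE_good: "AE \<omega> in M. good_path (?\<pi> \<omega>)"
    using AE_recurrent
  proof eventually_elim
    case (elim \<omega>)
    have "X i (i + Suc (k + Suc l)) \<omega> \<le> X i (i + Suc k) \<omega> + X (i + Suc k) (i + Suc k + Suc l) \<omega>"
      if "\<omega> \<in> G i" "\<omega> \<in> G (i + Suc k)" "\<omega> \<in> G (i + Suc k + Suc l)" for i k l
      using assms(5)[of i "i + Suc k" "i + Suc k + Suc l" \<omega>] that by (simp add: add.assoc)
    moreover have "X i (i + Suc k) \<omega> < \<infinity>" if "\<omega> \<in> G i" "\<omega> \<in> G (i + Suc k)" for i k
      using assms(4)[of i "i + Suc k" \<omega>] that by simp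
    ultimately show ?case
      using elim unfolding good_path_def by (auto simp: block_def indicator_eq_1_iff simp del: add_Suc_right)
  qed
  have le: "(\<integral>\<^sup>+\<omega>. ennreal \<bar>enn2real (X 0 n \<omega>) / real n - c\<bar> * indicator (G 0 \<inter> G n) \<omega> \<partial>M)
      \<le> ennreal (\<integral>x. \<bar>path_cost 0 n x / n - c\<bar> \<partial>Q)" if "n \<ge> 1" for n
  proof -
    have "(\<integral>\<^sup>+\<omega>. ennreal \<bar>enn2real (X 0 n \<omega>) / real n - c\<bar> * indicator (G 0 \<inter> G n) \<omega> \<partial>M)
        \<le> (\<integral>\<^sup>+\<omega>. ennreal \<bar>path_cost 0 n (?\<pi> \<omega>) / real n - c\<bar> \<partial>M)"
    proof (intro nn_integral_mono_AE)
      show "AE \<omega> in M. ennreal \<bar>enn2real (X 0 n \<omega>) / real n - c\<bar> * indicator (G 0 \<inter> G n) \<omega>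
          \<le> ennreal \<bar>path_cost 0 n (?\<pi> \<omega>) / real n - c\<bar>"
        \<comment> \<open>On \<open>G 0 \<inter> G n\<close> both endpoints are their own hits and
          \<open>n > 0\<close>, so the cost is \<open>X 0 n\<close> itself; elsewhere the left side
          is zero.\<close>
        using AE_good
      proof eventually_elim
        case (elim \<omega>)
        then show ?case
          using that path_cost_eq[OF elim, of n] by (auto simp: block_def split: split_indicator)
      qed
    qed
    also have "\<dots> = (\<integral>\<^sup>+x. ennreal \<bar>path_cost 0 n x / real n - c\<bar> \<partial>Q)"
      unfolding Q by (intro nn_integral_distr[symmetric]) auto
    also have "\<dots> = ennreal (\<integral>x. \<bar>path_cost 0 n x / n - c\<bar> \<partial>Q)"
      by (intro nn_integral_eq_integral) (use int[of n] in auto)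
    finally show ?thesis .
  qed
  have "(\<lambda>n. ennreal (\<integral>x. \<bar>path_cost 0 n x / n - c\<bar> \<partial>Q)) \<longlonglongrightarrow> 0"
    using tendsto_ennrealI[OF c(2)] by simp
  then have "(\<lambda>n. \<integral>\<^sup>+\<omega>. ennreal \<bar>enn2real (X 0 n \<omega>) / real n - c\<bar>
      * indicator (G 0 \<inter> G n) \<omega> \<partial>M) \<longlonglongrightarrow> 0"
  proof (rule tendsto_sandwich[OF _ _ tendsto_const, rotated 2])
    show "\<forall>\<^sub>F n in sequentially. (\<integral>\<^sup>+\<omega>. ennreal \<bar>enn2real (X 0 n \<omega>) / real n - c\<bar>
        * indicator (G 0 \<inter> G n) \<omega> \<partial>M) \<le> ennreal (\<integral>x. \<bar>path_cost 0 n x / n - c\<bar> \<partial>Q)"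
      using le by (rule eventually_sequentiallyI)
  qed simp
  with c(1) show ?thesis by blast
qed

end
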